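(* Let $D(x)=\mathbf{W}x$ be a linear operator on $\mathbb{R}^n$, where $\mathbf{W}\in\mathbb{R}^{n\times n}$ is diagonalizable with all eigenvalues in $[0,1]$, let $\mathbf{V}\in\mathbb{R}^{n\times n}$ be a matrix whose columns are linearly independent eigenvectors of $\mathbf{W}$, and equip $\mathbb{R}^n$ with the inner product $\langle x,y\rangle=(\mathbf{V}^{-1}x)^\top(\mathbf{V}^{-1}y)$ (an inner product induced by $D$). Let $g_D:\mathbb{R}^n\to\mathbb{R}\cup\{\infty\}$ be a closed, proper and convex function such that $D=\mathrm{Prox}_{g_D}$ on $(\mathbb{R}^n,\langle\cdot,\cdot\rangle)$. Let $f:\mathbb{R}^n\to\mathbb{R}$ be convex and let $\rho>0$. Assume that $y^\ast$ is a minimizer of $$\min_{x\in\mathbb{R}^n}\ f(x)+\rho\,g_D(x),$$ and let $p^\ast=f(y^\ast)+\rho\,g_D(y^\ast)$. Then, for any initialization $y_0,z_0\in\mathbb{R}^n$, for the PnP-ADMM iteration $$x_{k+1}=\mathrm{Prox}_{\rho^{-1}f}(y_k-z_k),\qquad y_{k+1}=D(x_{k+1}+z_k),\qquad z_{k+1}=z_k+x_{k+1}-y_{k+1},$$ we have: (a) the iterates $(y_k)_{k\ge0}$ converge to a minimizer of $f+\rho\,g_D$; and (b) $\lim_{k\to\infty} f(y_k)+\rho\,g_D(y_k)=p^\ast$.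
   Context: Let $\|\cdot\|$ be the norm induced by $\langle\cdot,\cdot\rangle$. Proximal operator on $(\mathbb{R}^n,\langle\cdot,\cdot\rangle)$: for closed, proper, convex $h:\mathbb{R}^n\to\mathbb{R}\cup\{\infty\}$, $\mathrm{Prox}_h(x)=\arg\min_{y}\ \tfrac12\|y-x\|^2+h(y)$; all proximal operators in the statement (including that of $\rho^{-1}f$) use this norm. (For $D$ and $\langle\cdot,\cdot\rangle$ as in the statement, a closed proper convex $g_D$ with $D=\mathrm{Prox}_{g_D}$ always exists.) *)

theory Defs
  imports "HOL-Analysis.Analysis"
begin

section \<open>Real eigenvectors and diagonalizability\<close>

definition eigenvector_of :: "real^'n^'n \<Rightarrow> real \<Rightarrow> real^'n \<Rightarrow> bool" where
  "eigenvector_of A l v \<longleftrightarrow> v \<noteq> 0 \<and> A *v v = l *\<^sub>R v"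

definition eigenvalue_of :: "real^'n^'n \<Rightarrow> real \<Rightarrow> bool" where
  "eigenvalue_of A l \<longleftrightarrow> (\<exists>v. eigenvector_of A l v)"

text \<open>Diagonalizability is over the reals, so a diagonalizable matrix has no non-real eigenvalue
  and it loses nothing to consider real eigenvalues only.\<close>

definition diagonalizable :: "real^'n^'n \<Rightarrow> bool" where
  "diagonalizable A \<longleftrightarrow>
     (\<exists>(P :: real^'n^'n) (L :: real^'n^'n). invertible P \<and> (\<forall>i j. i \<noteq> j \<longrightarrow> L $ i $ j = 0) \<and> A = P ** L ** matrix_inv P)"

text \<open>\<open>independent (columns V)\<close> concerns the set of columns and does not see repetitions,
  hence the injectivity condition.\<close>

definition independent_eigenvector_columns :: "real^'n^'n \<Rightarrow> real^'n^'n \<Rightarrow> bool" where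
  "independent_eigenvector_columns W V \<longleftrightarrow>
     (\<forall>j. \<exists>l. eigenvector_of W l (column j V)) \<and>
     inj (\<lambda>j. column j V) \<and> independent (columns V)"


section \<open>The inner product and norm determined by V\<close>

definition induced_inner :: "real^'n^'n \<Rightarrow> real^'n \<Rightarrow> real^'n \<Rightarrow> real" where
  "induced_inner V x y = (matrix_inv V *v x) \<bullet> (matrix_inv V *v y)"

definition induced_norm :: "real^'n^'n \<Rightarrow> real^'n \<Rightarrow> real" where
  "induced_norm V x = sqrt (induced_inner V x x)"


section \<open>Closed, proper, convex extended-real-valued functions\<close>

text \<open>Closedness refers to the standard topology; for invertible \<open>V\<close> it is also the topology
  of \<open>induced_norm V\<close>, as all norms on a finite-dimensional space are equivalent. The same remark
  applies to the convergence of sequences of vectors.\<close>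

definition ereal_epigraph :: "('a \<Rightarrow> ereal) \<Rightarrow> ('a \<times> real) set" where
  "ereal_epigraph h = {(x, t). h x \<le> ereal t}"

definition closed_fun :: "('a::euclidean_space \<Rightarrow> ereal) \<Rightarrow> bool" where
  "closed_fun h \<longleftrightarrow> closed (ereal_epigraph h)"

definition convex_fun :: "('a::euclidean_space \<Rightarrow> ereal) \<Rightarrow> bool" where
  "convex_fun h \<longleftrightarrow> convex (ereal_epigraph h)"

definition proper_fun :: "('a \<Rightarrow> ereal) \<Rightarrow> bool" where
  "proper_fun h \<longleftrightarrow> (\<forall>x. h x \<noteq> - \<infinity>) \<and> (\<exists>x. h x \<noteq> \<infinity>)"

abbreviation minimizer :: "('a \<Rightarrow> ereal) \<Rightarrow> 'a \<Rightarrow> bool" where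
  "minimizer F x \<equiv> is_arg_min F (\<lambda>_. True) x"


section \<open>Proximal operators\<close>

text \<open>For closed proper convex \<open>h\<close> and \<open>N\<close> the norm of an inner product, the minimizer exists and
  is unique, so the choice made by \<open>arg_min\<close> is the only possible one.\<close>

definition prox :: "('a::real_vector \<Rightarrow> real) \<Rightarrow> ('a \<Rightarrow> ereal) \<Rightarrow> 'a \<Rightarrow> 'a" where
  "prox N h x = (ARG_MIN (\<lambda>y. ereal (1 / 2 * (N (y - x))\<^sup>2) + h y) y. True)"

end

(* In the coordinates u = V^-1 x the induced norm is Euclidean, and s_k = V^-1 (x_(k+1) + z_k)
   follows the Douglas-Rachford iteration s + Q (2 P s - s) - P s of the proximal maps P of g and Q of
   f / rho, with P s_k = V^-1 y_(k+1). This operator is firmly nonexpansive, and the separation theorem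
   turns a minimizer into one of its fixed points, so its iterates converge to a fixed point t, and P t
   is a minimizer. For the values, g (P s_k) is squeezed between the bounds given by the subgradients
   t - P t at P t and s_k - P s_k at P s_k. *)

theory Submission
  imports Defs
begin

section \<open>Subgradients and proximal points\<close>

text \<open>Finiteness at \<open>p\<close> is part of the notion: at a value -\<infinity> the
  inequality would hold for every \<open>v\<close>, and real values are what the cancellations below
  rely on.\<close>

definition is_subgradient :: "('a::real_inner \<Rightarrow> ereal) \<Rightarrow> 'a \<Rightarrow> 'a \<Rightarrow> bool" where
  "is_subgradient h p v \<longleftrightarrow> \<bar>h p\<bar> \<noteq> \<infinity> \<and> (\<forall>u. h p + ereal (v \<bullet> (u - p)) \<le> h u)"

text \<open>Each subgradient inequality is tested at the base point of the other; in their sum the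
  values of \<open>h\<close> cancel.\<close>

lemma is_subgradient_monotone:
  assumes "is_subgradient h p v" "is_subgradient h q w"
  shows "0 \<le> (v - w) \<bullet> (p - q)"
proof -
  obtain a b where ab: "h p = ereal a" "h q = ereal b"
    using assms unfolding is_subgradient_def by fastforce
  have "h p + ereal (v \<bullet> (q - p)) \<le> h q" "h q + ereal (w \<bullet> (p - q)) \<le> h p"
    using assms unfolding is_subgradient_def by blast+
  then show ?thesis
    unfolding ab by (simp add: inner_diff_left inner_diff_right)
qed

section \<open>Proximal points: existence, optimality condition, uniqueness\<close>

lemma convex_fun_segment:
  assumes "convex_fun h" "h p = ereal a" "h u = ereal b" "0 \<le> t" "t \<le> 1"
  shows "h (p + t *\<^sub>R (u - p)) \<le> ereal (a + t * (b - a))"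
proof -
  have "(1 - t) *\<^sub>R (p, a) + t *\<^sub>R (u, b) \<in> ereal_epigraph h"
    using assms unfolding convex_fun_def
    by (intro convexD) (auto simp: ereal_epigraph_def)
  then show ?thesis
    by (simp add: ereal_epigraph_def algebra_simps)
qed

text \<open>A closed proper convex function has an affine minorant, so adding the quadratic makes
  the objective coercive. Minimizing over the epigraph instead of over the space replaces
  \<open>h\<close>, which need not be continuous, by the height coordinate, so that a continuous
  function is minimized over a compact set.\<close>

lemma prox_point_exists:
  fixes h :: "'a::euclidean_space \<Rightarrow> ereal"
  assumes h: "closed_fun h" "proper_fun h" "convex_fun h"
  shows "\<exists>p. minimizer (\<lambda>y. ereal (1 / 2 * (norm (y - x))\<^sup>2) + h y) p"
proof -
  define E where "E = ereal_epigraph h"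
  have E: "closed E" "convex E"
    using h by (auto simp: E_def closed_fun_def convex_fun_def)
  obtain x0 r0 where x0: "h x0 = ereal r0"
    using h(2) unfolding proper_fun_def by (metis ereal_cases)
  have in0: "(x0, r0) \<in> E" and notin0: "(x0, r0 - 1) \<notin> E"
    by (auto simp: E_def ereal_epigraph_def x0)
  \<comment> \<open>The point lies one unit below the graph at \<open>x0\<close>. Since
    \<open>(x0, r0)\<close> is on the other side of the hyperplane and has the same first component,
    the hyperplane is not vertical and can be solved for an affine minorant.\<close>
  from separating_hyperplane_closed_point[OF E(2,1) notin0] obtain w b
    where w: "w \<bullet> (x0, r0 - 1) < b" "\<And>e. e \<in> E \<Longrightarrow> b < w \<bullet> e"
    by blast
  obtain a \<beta> where [simp]: "w = (a, \<beta>)" by fastforce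
  have \<beta>: "\<beta> > 0"
    using w(1) w(2)[OF in0] by (simp add: algebra_simps)
  define d where "d = - (inverse \<beta>) *\<^sub>R a"
  define c where "c = b / \<beta>"
  have minorant: "c + d \<bullet> y \<le> t" if "(y, t) \<in> E" for y t
    using w(2)[OF that] \<beta> by (simp add: c_def d_def field_simps)
  define \<psi> where "\<psi> = (\<lambda>e::'a \<times> real. 1 / 2 * (norm (fst e - x))\<^sup>2 + snd e)"
  define c0 where "c0 = \<psi> (x0, r0)"
  define S where "S = E \<inter> {e. \<psi> e \<le> c0}"
  have cont: "continuous_on A \<psi>" for A
    unfolding \<psi>_def by (intro continuous_intros)
  \<comment> \<open>On \<open>S\<close> the minorant and the bound \<open>c0\<close> give n^2 - 2
    |d| n \<le> 2K for n = \<open>norm (y - x)\<close>. Completing the square bounds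
    \<open>m\<^sup>2\<close> for m = n - |d|, and m \<le> 1 + \<open>m\<^sup>2\<close> turns this
    into n \<le> R without a square root.\<close>
  define K where "K = c0 - c - d \<bullet> x"
  define R where "R = norm d + 1 + 2 * K + (norm d)\<^sup>2"
  have "S \<subseteq> cball x R \<times> {c + d \<bullet> x - norm d * R..c0}"
  proof
    fix e assume e: "e \<in> S"
    obtain y t where [simp]: "e = (y, t)" by fastforce
    have yt: "c + d \<bullet> y \<le> t" "1 / 2 * (norm (y - x))\<^sup>2 + t \<le> c0"
      using e minorant by (auto simp: S_def \<psi>_def)
    have dy: "d \<bullet> x - norm d * norm (y - x) \<le> d \<bullet> y"
      using Cauchy_Schwarz_ineq2[of d "y - x"] by (simp add: inner_diff_right)
    define m where "m = norm (y - x) - norm d"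
    have "m\<^sup>2 \<le> 2 * K + (norm d)\<^sup>2"
      using yt dy by (simp add: m_def K_def power2_eq_square algebra_simps)
    moreover have "m \<le> 1 + m\<^sup>2"
      using zero_le_power2[of "m - 1"] zero_le_power2[of m] unfolding power2_diff
      by (simp, linarith)
    ultimately have n: "norm (y - x) \<le> R"
      by (simp add: m_def R_def)
    then have "norm d * norm (y - x) \<le> norm d * R"
      by (simp add: mult_left_mono)
    then have "c + d \<bullet> x - norm d * R \<le> t"
      using yt dy by linarith
    moreover have "t \<le> c0"
      using yt(2) zero_le_power2[of "norm (y - x)"] by linarith
    ultimately show "e \<in> cball x R \<times> {c + d \<bullet> x - norm d * R..c0}"
      using n by (simp add: dist_norm norm_minus_commute)
  qed
  then have "bounded S"
    by (rule bounded_subset[rotated]) (intro bounded_Times bounded_cball bounded_closed_interval)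
  moreover have "closed S"
    unfolding S_def using E(1) cont
    by (intro closed_Int closed_Collect_le) (auto intro: continuous_intros)
  ultimately have "compact S"
    by (simp add: compact_eq_bounded_closed)
  moreover have "(x0, r0) \<in> S"
    using in0 by (simp add: S_def c0_def)
  ultimately have "\<exists>e\<in>S. \<forall>e'\<in>S. \<psi> e \<le> \<psi> e'"
    by (intro continuous_attains_inf cont) auto
  then obtain e where e: "e \<in> S" "\<And>e'. e' \<in> S \<Longrightarrow> \<psi> e \<le> \<psi> e'"
    by blast
  obtain p t where pt: "e = (p, t)" by fastforce
  have hp: "h p \<le> ereal t"
    using e(1) by (simp add: S_def E_def ereal_epigraph_def pt)
  have "ereal (1 / 2 * (norm (p - x))\<^sup>2) + h p \<le> ereal (1 / 2 * (norm (y - x))\<^sup>2) + h y" for y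
  proof (cases "h y")
    case (real r)
    then have "(y, r) \<in> E"
      by (simp add: E_def ereal_epigraph_def)
    \<comment> \<open>Outside \<open>S\<close> the value of \<open>\<psi>\<close> exceeds
      \<open>c0\<close>, which already bounds its value at \<open>e\<close>, so \<open>e\<close> is
      minimal over the whole epigraph.\<close>
    then have "\<psi> (p, t) \<le> \<psi> (y, r)"
      using e pt unfolding S_def by (cases "\<psi> (y, r) \<le> c0") auto
    then have "ereal (1 / 2 * (norm (p - x))\<^sup>2) + ereal t \<le> ereal (1 / 2 * (norm (y - x))\<^sup>2) + h y"
      by (simp add: \<psi>_def real)
    then show ?thesis
      using hp by (meson add_left_mono order_trans)
  next
    case PInf
    then show ?thesis by simp
  next
    case MInf
    then show ?thesis using h(2) by (simp add: proper_fun_def)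
  qed
  then show ?thesis
    unfolding is_arg_min_linorder by blast
qed

text \<open>First-order optimality along the segment from \<open>p\<close> to \<open>u\<close>:
  compare the objective at \<open>p\<close> with its value at parameter t, divide by t, and let t
  tend to 0 from the right.\<close>

lemma minimizer_imp_subgradient:
  fixes h :: "'a::euclidean_space \<Rightarrow> ereal"
  assumes h: "proper_fun h" "convex_fun h"
    and p: "minimizer (\<lambda>y. ereal (1 / 2 * (norm (y - x))\<^sup>2) + h y) p"
  shows "is_subgradient h p (x - p)"
proof -
  have min: "ereal (1 / 2 * (norm (p - x))\<^sup>2) + h p \<le> ereal (1 / 2 * (norm (y - x))\<^sup>2) + h y" for y
    using p by (simp add: is_arg_min_linorder)
  obtain x0 r0 where x0: "h x0 = ereal r0"
    using h(1) unfolding proper_fun_def by (metis ereal_cases)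
  have "h p \<noteq> \<infinity>" "h p \<noteq> - \<infinity>"
    using min[of x0] h(1) by (auto simp: x0 proper_fun_def)
  then obtain a where a: "h p = ereal a"
    by (cases "h p") auto
  have "h p + ereal ((x - p) \<bullet> (u - p)) \<le> h u" for u
  proof (cases "h u")
    case (real b)
    \<comment> \<open>The coefficient of t in the upper bound for the growth of the objective along
      the segment; the remainder is quadratic in t.\<close>
    define D where "D = (p - x) \<bullet> (u - p) + (b - a)"
    have "0 \<le> D + t * (1 / 2 * (norm (u - p))\<^sup>2)" if t: "0 < t" "t < 1" for t
    proof -
      have "ereal (1 / 2 * (norm (p - x))\<^sup>2) + h p
            \<le> ereal (1 / 2 * (norm (p + t *\<^sub>R (u - p) - x))\<^sup>2) + ereal (a + t * (b - a))"
        using min[of "p + t *\<^sub>R (u - p)"] convex_fun_segment[OF h(2) a real, of t] t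
        by (meson add_left_mono less_imp_le order_trans)
      moreover have "(norm (p + t *\<^sub>R (u - p) - x))\<^sup>2
          = (norm (p - x))\<^sup>2 + 2 * t * ((p - x) \<bullet> (u - p)) + t\<^sup>2 * (norm (u - p))\<^sup>2"
      proof -
        have "p + t *\<^sub>R (u - p) - x = (p - x) + t *\<^sub>R (u - p)" by simp
        then show ?thesis
          by (simp only: inner_add_left inner_add_right power2_norm_eq_inner inner_scaleR_left inner_scaleR_right)
            (simp add: inner_commute[of "u - p" "p - x"] power2_eq_square distrib_left)
      qed
      ultimately have "0 \<le> t * (D + t * (1 / 2 * (norm (u - p))\<^sup>2))"
        by (simp add: a D_def algebra_simps power2_eq_square)
      then show ?thesis
        using t by (simp add: zero_le_mult_iff)
    qed
    then have "\<forall>\<^sub>F t in at_right 0. 0 \<le> D + t * (1 / 2 * (norm (u - p))\<^sup>2)"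
      by (intro eventually_at_rightI[of 0 1]) auto
    moreover have "((\<lambda>t. D + t * (1 / 2 * (norm (u - p))\<^sup>2))
        \<longlongrightarrow> D + 0 * (1 / 2 * (norm (u - p))\<^sup>2)) (at_right 0)"
      by (intro tendsto_intros)
    ultimately have "0 \<le> D + 0 * (1 / 2 * (norm (u - p))\<^sup>2)"
      by (intro tendsto_lowerbound) auto
    then show ?thesis
      by (simp add: a real D_def inner_diff_left)
  next
    case PInf
    then show ?thesis by simp
  next
    case MInf
    then show ?thesis using h(1) by (simp add: proper_fun_def)
  qed
  then show ?thesis
    by (simp add: is_subgradient_def a)
qed

lemma prox_is_minimizer:
  fixes h :: "'a::euclidean_space \<Rightarrow> ereal"
  assumes "closed_fun h" "proper_fun h" "convex_fun h"
  shows "minimizer (\<lambda>y. ereal (1 / 2 * (norm (y - x))\<^sup>2) + h y) (prox norm h x)"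
  unfolding prox_def arg_min_def using someI_ex[OF prox_point_exists[OF assms]] .

lemma prox_subgradient:
  fixes h :: "'a::euclidean_space \<Rightarrow> ereal"
  assumes "closed_fun h" "proper_fun h" "convex_fun h"
  shows "is_subgradient h (prox norm h x) (x - prox norm h x)"
  using minimizer_imp_subgradient prox_is_minimizer assms by blast

text \<open>Both points carry the subgradient "\<open>x\<close> minus the point", so monotonicity
  makes minus their squared distance nonnegative. With \<open>prox_subgradient\<close> this
  characterizes the proximal point by a subgradient.\<close>

lemma prox_eqI:
  fixes h :: "'a::euclidean_space \<Rightarrow> ereal"
  assumes "closed_fun h" "proper_fun h" "convex_fun h" and "is_subgradient h p (x - p)"
  shows "prox norm h x = p"
proof -
  have "0 \<le> (x - prox norm h x - (x - p)) \<bullet> (prox norm h x - p)"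
    using is_subgradient_monotone prox_subgradient assms by blast
  also have "\<dots> = - ((prox norm h x - p) \<bullet> (prox norm h x - p))"
    by (simp add: inner_diff_left inner_diff_right inner_commute)
  finally show ?thesis
    by (metis eq_iff_diff_eq_0 inner_eq_zero_iff inner_ge_zero neg_0_le_iff_le order_antisym)
qed

section \<open>Linear changes of coordinates, and convex real-valued functions as a special
  case\<close>

lemma prox_linear_change:
  fixes A B :: "'a::euclidean_space \<Rightarrow> 'a"
  assumes h: "closed_fun (h \<circ> B)" "proper_fun (h \<circ> B)" "convex_fun (h \<circ> B)"
    and A: "linear A" and AB: "\<And>u. A (B u) = u" "\<And>u. B (A u) = u"
  shows "prox (\<lambda>u. norm (A u)) h x = B (prox norm (h \<circ> B) (A x))"
proof -
  let ?\<phi> = "\<lambda>y. ereal (1 / 2 * (norm (A (y - x)))\<^sup>2) + h y"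
  let ?\<psi> = "\<lambda>v. ereal (1 / 2 * (norm (v - A x))\<^sup>2) + (h \<circ> B) v"
  \<comment> \<open>The substitution v = \<open>A y\<close> turns the objective for the transported
    norm into a Euclidean one, so minimizers correspond under \<open>A\<close>; uniqueness on the
    Euclidean side then identifies the chosen points.\<close>
  have eq: "?\<phi> y = ?\<psi> (A y)" for y
    by (simp add: linear_diff[OF A] AB)
  have iff: "minimizer ?\<phi> q \<longleftrightarrow> minimizer ?\<psi> (A q)" for q
    unfolding is_arg_min_linorder eq by (metis AB(1))
  have "minimizer ?\<phi> (B (prox norm (h \<circ> B) (A x)))"
    unfolding iff AB by (rule prox_is_minimizer[OF h])
  then have "minimizer ?\<phi> (prox (\<lambda>u. norm (A u)) h x)"
    unfolding prox_def arg_min_def by (rule someI)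
  then have "minimizer ?\<psi> (A (prox (\<lambda>u. norm (A u)) h x))"
    unfolding iff .
  then have "prox norm (h \<circ> B) (A x) = A (prox (\<lambda>u. norm (A u)) h x)"
    using h by (intro prox_eqI minimizer_imp_subgradient) auto
  then show ?thesis by (simp add: AB)
qed

lemma closed_convex_fun_comp_linear:
  fixes B :: "'a::euclidean_space \<Rightarrow> 'b::euclidean_space"
  assumes B: "linear B"
  shows "closed_fun h \<Longrightarrow> closed_fun (h \<circ> B)" "convex_fun h \<Longrightarrow> convex_fun (h \<circ> B)"
proof -
  let ?M = "\<lambda>e::'a \<times> real. (B (fst e), snd e)"
  have eq: "ereal_epigraph (h \<circ> B) = ?M -` ereal_epigraph h"
    by (auto simp: ereal_epigraph_def)
  have M: "linear ?M"
    by (rule linearI) (auto simp: linear_add[OF B] linear_scale[OF B])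
  show "closed_fun h \<Longrightarrow> closed_fun (h \<circ> B)"
    unfolding closed_fun_def eq
    by (intro continuous_closed_vimage linear_continuous_at) (use M linear_conv_bounded_linear in auto)
  show "convex_fun h \<Longrightarrow> convex_fun (h \<circ> B)"
    unfolding convex_fun_def eq by (rule convex_linear_vimage[OF M])
qed

lemma convex_on_imp_closed_proper_convex:
  fixes f :: "'a::euclidean_space \<Rightarrow> real"
  assumes "convex_on UNIV f"
  shows "closed_fun (\<lambda>u. ereal (f u))" "proper_fun (\<lambda>u. ereal (f u))" "convex_fun (\<lambda>u. ereal (f u))"
proof -
  have cont: "continuous_on UNIV f"
    using assms by (simp add: convex_on_continuous)
  have eq: "ereal_epigraph (\<lambda>u. ereal (f u)) = epigraph UNIV f"
    by (auto simp: ereal_epigraph_def epigraph_def)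
  have "closed {e::'a \<times> real. f (fst e) \<le> snd e}"
    by (intro closed_Collect_le continuous_intros continuous_on_compose2[OF cont]) auto
  then show "closed_fun (\<lambda>u. ereal (f u))"
    unfolding closed_fun_def eq by (simp add: epigraph_def)
  show "proper_fun (\<lambda>u. ereal (f u))"
    by (simp add: proper_fun_def)
  show "convex_fun (\<lambda>u. ereal (f u))"
    unfolding convex_fun_def eq using assms by (simp add: convex_epigraph)
qed

section \<open>Subgradient optimality conditions for a sum\<close>

text \<open>Since \<open>F\<close> is finite everywhere, a hyperplane separating its strict epigraph from the
  hypograph of \<open>c - g\<close>, where \<open>c\<close> is the minimal value, cannot be vertical.\<close>

lemma minimizer_sum_subgradients:
  fixes F :: "'a::euclidean_space \<Rightarrow> real"
  assumes F: "convex_on UNIV F" and g: "proper_fun g" "convex_fun g"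
    and p: "minimizer (\<lambda>u. ereal (F u) + g u) p"
  shows "\<exists>v. is_subgradient (\<lambda>u. ereal (F u)) p (- v) \<and> is_subgradient g p v"
proof -
  have min: "ereal (F p) + g p \<le> ereal (F u) + g u" for u
    using p by (simp add: is_arg_min_linorder)
  obtain x0 r0 where x0: "g x0 = ereal r0"
    using g(1) unfolding proper_fun_def by (metis ereal_cases)
  have "g p \<noteq> \<infinity>" "g p \<noteq> - \<infinity>"
    using min[of x0] g(1) by (auto simp: x0 proper_fun_def)
  then obtain r where r: "g p = ereal r"
    by (cases "g p") auto
  define S where "S = {e::'a \<times> real. F (fst e) < snd e}"
  define U where "U = (\<lambda>e::'a \<times> real. (fst e, F p + r - snd e)) ` ereal_epigraph g"
  have "convex S"
  proof (rule convexI)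
    fix e e' and s t :: real
    assume e: "e \<in> S" "e' \<in> S" and st: "0 \<le> s" "0 \<le> t" "s + t = 1"
    have "F (s *\<^sub>R fst e + t *\<^sub>R fst e') \<le> s * F (fst e) + t * F (fst e')"
      using F st by (auto simp: convex_on_def)
    also have "\<dots> < s * snd e + t * snd e'"
    proof (cases "s = 0")
      case True
      then show ?thesis using e st by (simp add: S_def)
    next
      case False
      then have "s * F (fst e) < s * snd e" "t * F (fst e') \<le> t * snd e'"
        using e st by (auto simp: S_def mult_left_mono)
      then show ?thesis by linarith
    qed
    finally show "s *\<^sub>R e + t *\<^sub>R e' \<in> S"
      by (simp add: S_def)
  qed
  have "convex U"
  proof (rule convexI)
    fix e e' and s t :: real
    assume e: "e \<in> U" "e' \<in> U" and st: "0 \<le> s" "0 \<le> t" "s + t = 1"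
    obtain d d' where d: "d \<in> ereal_epigraph g" "e = (fst d, F p + r - snd d)"
      "d' \<in> ereal_epigraph g" "e' = (fst d', F p + r - snd d')"
      using e unfolding U_def by blast
    have "s *\<^sub>R d + t *\<^sub>R d' \<in> ereal_epigraph g"
      using g(2) d st unfolding convex_fun_def by (auto intro: convexD)
    moreover have "s * (F p + r - snd d) + t * (F p + r - snd d')
        = (s + t) * (F p + r) - (s * snd d + t * snd d')"
      by (simp add: algebra_simps)
    then have "s *\<^sub>R e + t *\<^sub>R e' = (fst (s *\<^sub>R d + t *\<^sub>R d'), F p + r - snd (s *\<^sub>R d + t *\<^sub>R d'))"
      by (simp add: d st)
    ultimately show "s *\<^sub>R e + t *\<^sub>R e' \<in> U"
      unfolding U_def by blast
  qed
  have "S \<inter> U = {}"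
  proof -
    have False if "F u < F p + r - t" "g u \<le> ereal t" for u t
    proof -
      have "ereal (F p) + g p \<le> ereal (F u) + ereal t"
        using min[of u] that(2) by (meson add_left_mono order_trans)
      then show False using that(1) by (simp add: r)
    qed
    then show ?thesis
      by (auto simp: S_def U_def ereal_epigraph_def)
  qed
  have p_U: "(p, F p) \<in> U"
    unfolding U_def by (rule image_eqI[of _ _ "(p, r)"]) (auto simp: ereal_epigraph_def r)
  have p_S: "(p, F p + 1) \<in> S"
    by (simp add: S_def)
  obtain w c where w: "w \<noteq> 0" "\<And>e. e \<in> U \<Longrightarrow> w \<bullet> e \<le> c" "\<And>e. e \<in> S \<Longrightarrow> c \<le> w \<bullet> e"
    using separating_hyperplane_sets[OF \<open>convex U\<close> \<open>convex S\<close>] p_U p_S \<open>S \<inter> U = {}\<close>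
    by (metis empty_iff inf_commute)
  obtain a \<beta> where wa: "w = (a, \<beta>)" by fastforce
  \<comment> \<open>The separation concerns points strictly above the graph of \<open>F\<close>;
    lowering their height to the graph keeps the bound. The sign of \<open>\<beta>\<close> is still
    open, hence the absolute value in the choice of \<open>\<delta>\<close>.\<close>
  have le: "c \<le> a \<bullet> u + \<beta> * F u" for u
  proof (rule field_le_epsilon)
    fix \<epsilon> :: real assume "\<epsilon> > 0"
    define \<delta> where "\<delta> = \<epsilon> / (1 + \<bar>\<beta>\<bar>)"
    have "\<delta> > 0"
      using \<open>\<epsilon> > 0\<close> by (simp add: \<delta>_def add_pos_nonneg)
    moreover have "\<beta> * \<delta> \<le> (1 + \<bar>\<beta>\<bar>) * \<delta>"
      using \<open>\<delta> > 0\<close> by (intro mult_right_mono) auto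
    then have "\<beta> * \<delta> \<le> \<epsilon>"
      by (simp add: \<delta>_def)
    moreover have "c \<le> a \<bullet> u + \<beta> * (F u + \<delta>)"
      using w(3)[of "(u, F u + \<delta>)"] \<open>\<delta> > 0\<close> by (simp add: S_def wa)
    ultimately show "c \<le> a \<bullet> u + \<beta> * F u + \<epsilon>"
      by (simp add: algebra_simps)
  qed
  \<comment> \<open>\<open>(p, F p)\<close> belongs to \<open>U\<close> and lies on the graph of
    \<open>F\<close>, so the hyperplane passes through it.\<close>
  have c: "c = a \<bullet> p + \<beta> * F p"
    using w(2)[OF p_U] le[of p] by (simp add: wa)
  have "\<beta> \<ge> 0"
    using w(2)[OF p_U] w(3)[OF p_S] by (simp add: wa algebra_simps)
  moreover have "\<beta> \<noteq> 0"
  proof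
    assume "\<beta> = 0"
    \<comment> \<open>For a vertical hyperplane the linear form given by \<open>a\<close> would be
      minimal at \<open>p\<close>; moving by \<open>- a\<close> forces \<open>a\<close> = 0,
      contradicting \<open>w \<noteq> 0\<close>.\<close>
    then have "a \<bullet> p \<le> a \<bullet> (p - a)"
      using le[of "p - a"] c by simp
    then have "a \<bullet> a \<le> 0"
      by (simp add: inner_diff_right)
    then show False
      using w(1) \<open>\<beta> = 0\<close> by (metis wa inner_eq_zero_iff inner_ge_zero order_antisym zero_prod_def)
  qed
  ultimately have \<beta>: "\<beta> > 0" by simp
  \<comment> \<open>The normalized slope: the side containing \<open>S\<close> gives the subgradient
    \<open>- v\<close> of \<open>F\<close>, the side containing \<open>U\<close> gives
    \<open>v\<close> for \<open>g\<close>.\<close>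
  define v where "v = inverse \<beta> *\<^sub>R a"
  have v: "a \<bullet> u = \<beta> * (v \<bullet> u)" for u
    using \<beta> by (simp add: v_def)
  have "F p + (- v) \<bullet> (u - p) \<le> F u" for u
  proof -
    have "0 \<le> \<beta> * (F u - (F p + (- v) \<bullet> (u - p)))"
      using le[of u] unfolding c v by (simp add: algebra_simps)
    then show ?thesis using \<beta> by (simp add: zero_le_mult_iff)
  qed
  then have "is_subgradient (\<lambda>u. ereal (F u)) p (- v)"
    by (simp add: is_subgradient_def)
  moreover have "g p + ereal (v \<bullet> (u - p)) \<le> g u" for u
  proof (cases "g u")
    case (real t)
    then have "(u, F p + r - t) \<in> U"
      unfolding U_def by (intro image_eqI[of _ _ "(u, t)"]) (auto simp: ereal_epigraph_def)
    from w(2)[OF this] have "0 \<le> \<beta> * (t - (r + v \<bullet> (u - p)))"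
      unfolding c wa by (simp add: v algebra_simps)
    then show ?thesis using \<beta> by (simp add: zero_le_mult_iff real r)
  next
    case PInf
    then show ?thesis by simp
  next
    case MInf
    then show ?thesis using g(1) by (simp add: proper_fun_def)
  qed
  then have "is_subgradient g p v"
    by (simp add: is_subgradient_def r)
  ultimately show ?thesis by blast
qed

text \<open>The opposite slopes cancel when the two inequalities are added; this is the converse of
  the separation argument.\<close>

lemma subgradients_sum_minimizer:
  assumes "is_subgradient (\<lambda>u. ereal (F u)) p (- v)" "is_subgradient g p v"
  shows "minimizer (\<lambda>u. ereal (F u) + g u) p"
  unfolding is_arg_min_linorder
proof (intro conjI allI impI TrueI)
  fix u
  obtain r where r: "g p = ereal r"
    using assms(2) unfolding is_subgradient_def by fastforce
  have 1: "F p - v \<bullet> (u - p) \<le> F u"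
    using assms(1) by (simp add: is_subgradient_def)
  have 2: "ereal (r + v \<bullet> (u - p)) \<le> g u"
    using assms(2) by (auto simp: is_subgradient_def r)
  have "ereal (F p) + g p = ereal (F p - v \<bullet> (u - p)) + ereal (r + v \<bullet> (u - p))"
    by (simp add: r)
  also have "\<dots> \<le> ereal (F u) + g u"
    using 1 2 by (intro add_mono) auto
  finally show "ereal (F p) + g p \<le> ereal (F u) + g u" .
qed

section \<open>Firmly nonexpansive maps\<close>

definition firmly_nonexpansive :: "('a::real_inner \<Rightarrow> 'a) \<Rightarrow> bool" where
  "firmly_nonexpansive T \<longleftrightarrow> (\<forall>u v. (norm (T u - T v))\<^sup>2 \<le> (T u - T v) \<bullet> (u - v))"

lemma firmly_nonexpansive_dist:
  assumes "firmly_nonexpansive T"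
  shows "dist (T u) (T v) \<le> dist u v"
proof (cases "T u = T v")
  case False
  have "(norm (T u - T v))\<^sup>2 \<le> norm (T u - T v) * norm (u - v)"
    using assms norm_cauchy_schwarz unfolding firmly_nonexpansive_def by (meson order_trans)
  then show ?thesis using False by (simp add: power2_eq_square dist_norm)
qed simp

lemma firmly_nonexpansive_tendsto:
  assumes "firmly_nonexpansive T" "(a \<longlongrightarrow> l) F"
  shows "((\<lambda>k. T (a k)) \<longlongrightarrow> T l) F"
proof (rule tendstoI)
  fix e :: real assume "e > 0"
  from tendstoD[OF assms(2) this] show "\<forall>\<^sub>F k in F. dist (T (a k)) (T l) < e"
    by (rule eventually_mono) (rule le_less_trans[OF firmly_nonexpansive_dist[OF assms(1)]])
qed

text \<open>This is the monotonicity of the subgradients \<open>u - ?P u\<close> and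
  \<open>v - ?P v\<close>, rearranged.\<close>

lemma firmly_nonexpansive_prox:
  fixes h :: "'a::euclidean_space \<Rightarrow> ereal"
  assumes "closed_fun h" "proper_fun h" "convex_fun h"
  shows "firmly_nonexpansive (prox norm h)"
  unfolding firmly_nonexpansive_def
proof (intro allI)
  fix u v
  let ?P = "prox norm h"
  have "0 \<le> (u - ?P u - (v - ?P v)) \<bullet> (?P u - ?P v)"
    by (intro is_subgradient_monotone[of h] prox_subgradient assms)
  then show "(norm (?P u - ?P v))\<^sup>2 \<le> (?P u - ?P v) \<bullet> (u - v)"
    by (simp add: power2_norm_eq_inner inner_diff_left inner_diff_right inner_commute)
qed

text \<open>In terms of the differences \<open>\<sigma>\<close>, \<open>b\<close>, \<open>c\<close>,
  the inequality to be shown is exactly the sum of the one for \<open>P\<close> at (u, v) and the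
  one for \<open>Q\<close> at the reflected points.\<close>

lemma firmly_nonexpansive_douglas_rachford:
  assumes P: "firmly_nonexpansive P" and Q: "firmly_nonexpansive Q"
  shows "firmly_nonexpansive (\<lambda>s. s + Q (2 *\<^sub>R P s - s) - P s)"
  unfolding firmly_nonexpansive_def
proof (intro allI)
  fix u v
  define \<sigma> b c where "\<sigma> = u - v" and "b = P u - P v"
    and "c = Q (2 *\<^sub>R P u - u) - Q (2 *\<^sub>R P v - v)"
  have "b \<bullet> b \<le> b \<bullet> \<sigma>"
    using P by (simp add: firmly_nonexpansive_def b_def \<sigma>_def power2_norm_eq_inner)
  moreover have "c \<bullet> c \<le> c \<bullet> (2 *\<^sub>R P u - u - (2 *\<^sub>R P v - v))"
    using Q by (simp add: firmly_nonexpansive_def c_def power2_norm_eq_inner)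
  then have "c \<bullet> c \<le> c \<bullet> (2 *\<^sub>R b - \<sigma>)"
    by (simp add: b_def \<sigma>_def algebra_simps)
  ultimately have "(\<sigma> + c - b) \<bullet> (\<sigma> + c - b) \<le> (\<sigma> + c - b) \<bullet> \<sigma>"
    by (simp add: inner_simps inner_commute)
  then show "(norm (u + Q (2 *\<^sub>R P u - u) - P u - (v + Q (2 *\<^sub>R P v - v) - P v)))\<^sup>2
      \<le> (u + Q (2 *\<^sub>R P u - u) - P u - (v + Q (2 *\<^sub>R P v - v) - P v)) \<bullet> (u - v)"
    by (simp add: power2_norm_eq_inner \<sigma>_def b_def c_def algebra_simps)
qed

text \<open>Distances to each fixed point decrease and the steps tend to 0. By boundedness some
  subsequence converges, its limit is fixed because the steps vanish, and monotonicity of the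
  distance to this limit gives convergence of the whole sequence.\<close>

lemma firmly_nonexpansive_iterates_converge:
  fixes T :: "'a::euclidean_space \<Rightarrow> 'a"
  assumes T: "firmly_nonexpansive T" and fixpoint: "T q = q"
    and s: "\<And>k. s (Suc k) = T (s k)"
  shows "\<exists>l. T l = l \<and> s \<longlonglongrightarrow> l"
proof -
  have dec: "dist (s (Suc k)) l \<le> dist (s k) l" if "T l = l" for l k
    using firmly_nonexpansive_dist[OF T, of "s k" l] that s by simp
  have decseq: "decseq (\<lambda>k. dist (s k) l)" if "T l = l" for l
    using dec[OF that] by (simp add: decseq_Suc_iff)
  \<comment> \<open>Expand |a - b|^2 for a = \<open>T (s k) - q\<close> and b =
    \<open>s k - q\<close>, using |a|^2 \<le> a \<bullet> b. The right-hand side tends to 0 because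
    the distances to \<open>q\<close> converge.\<close>
  have step: "(norm (s (Suc k) - s k))\<^sup>2 \<le> (dist (s k) q)\<^sup>2 - (dist (s (Suc k)) q)\<^sup>2" for k
  proof -
    have "(norm (T (s k) - T q))\<^sup>2 \<le> (T (s k) - T q) \<bullet> (s k - q)"
      using T by (simp add: firmly_nonexpansive_def)
    then show ?thesis
      by (simp add: fixpoint s dist_norm power2_norm_eq_inner inner_simps inner_commute)
  qed
  obtain d where "(\<lambda>k. dist (s k) q) \<longlonglongrightarrow> d"
    using decseq_convergent[OF decseq[OF fixpoint], of 0] zero_le_dist by blast
  then have "(\<lambda>k. (dist (s k) q)\<^sup>2 - (dist (s (Suc k)) q)\<^sup>2) \<longlonglongrightarrow> d\<^sup>2 - d\<^sup>2"
    by (intro tendsto_intros LIMSEQ_Suc)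
  then have "(\<lambda>k. (dist (s k) q)\<^sup>2 - (dist (s (Suc k)) q)\<^sup>2) \<longlonglongrightarrow> 0"
    by simp
  then have "(\<lambda>k. (norm (s (Suc k) - s k))\<^sup>2) \<longlonglongrightarrow> 0"
    by (rule Lim_null_comparison[rotated]) (use step in simp)
  then have "(\<lambda>k. sqrt ((norm (s (Suc k) - s k))\<^sup>2)) \<longlonglongrightarrow> sqrt 0"
    by (intro tendsto_intros)
  then have diff: "(\<lambda>k. T (s k) - s k) \<longlonglongrightarrow> 0"
    by (simp add: tendsto_norm_zero_iff s)
  have "s k \<in> cball q (dist (s 0) q)" for k
    using decseqD[OF decseq[OF fixpoint], of 0 k] by (simp add: dist_commute)
  then obtain l r where l: "strict_mono r" "(s \<circ> r) \<longlonglongrightarrow> l"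
    using compact_cball[of q "dist (s 0) q"] unfolding compact_def by metis
  have "(\<lambda>k. T ((s \<circ> r) k)) \<longlonglongrightarrow> T l"
    by (rule firmly_nonexpansive_tendsto[OF T l(2)])
  then have "(\<lambda>k. T ((s \<circ> r) k) - (s \<circ> r) k) \<longlonglongrightarrow> T l - l"
    using l(2) by (intro tendsto_intros)
  moreover have "(\<lambda>k. T ((s \<circ> r) k) - (s \<circ> r) k) \<longlonglongrightarrow> 0"
    using LIMSEQ_subseq_LIMSEQ[OF diff l(1)] by (simp add: o_def)
  ultimately have Tl: "T l = l"
    using LIMSEQ_unique by fastforce
  have "s \<longlonglongrightarrow> l"
  proof (rule metric_LIMSEQ_I)
    fix \<epsilon> :: real assume "\<epsilon> > 0"
    \<comment> \<open>A single close index suffices, since the distance to the fixed point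
      \<open>l\<close> never increases afterwards.\<close>
    then obtain n where "dist (s (r n)) l < \<epsilon>"
      using metric_LIMSEQ_D[OF l(2)] by fastforce
    then show "\<exists>no. \<forall>n\<ge>no. dist (s n) l < \<epsilon>"
      using decseqD[OF decseq[OF Tl]] by (meson le_less_trans)
  qed
  then show ?thesis using Tl by blast
qed

section \<open>Convergence of PnP-ADMM\<close>

text \<open>The values of \<open>g\<close> get a claim of their own because \<open>g\<close> is only
  closed: convergence of the points alone does not give it.\<close>

lemma douglas_rachford_converges:
  fixes F :: "'a::euclidean_space \<Rightarrow> real" and g :: "'a \<Rightarrow> ereal"
  assumes F: "convex_on UNIV F" and g: "closed_fun g" "proper_fun g" "convex_fun g"
    and ex: "minimizer (\<lambda>u. ereal (F u) + g u) p"
    and s: "\<And>k. s (Suc k) = s k + prox norm (\<lambda>u. ereal (F u)) (2 *\<^sub>R prox norm g (s k) - s k) - prox norm g (s k)"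
  shows "\<exists>l. minimizer (\<lambda>u. ereal (F u) + g u) l \<and> (\<lambda>k. prox norm g (s k)) \<longlonglongrightarrow> l
    \<and> (\<lambda>k. g (prox norm g (s k))) \<longlonglongrightarrow> g l"
proof -
  define P Q where "P = prox norm g" and "Q = prox norm (\<lambda>u. ereal (F u))"
  note F' = convex_on_imp_closed_proper_convex[OF F]
  have fn: "firmly_nonexpansive P" "firmly_nonexpansive Q"
    unfolding P_def Q_def by (intro firmly_nonexpansive_prox g F')+
  have sub_P: "is_subgradient g (P t) (t - P t)" for t
    unfolding P_def by (rule prox_subgradient[OF g])
  obtain v where v: "is_subgradient (\<lambda>u. ereal (F u)) p (- v)" "is_subgradient g p v"
    using minimizer_sum_subgradients[OF F g(2,3) ex] by blast
  \<comment> \<open>From the minimizer \<open>p\<close> a fixed point \<open>p + v\<close> is built: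
    \<open>P\<close> sends it to \<open>p\<close>, the reflection is \<open>p - v\<close>, and
    \<open>Q\<close> sends that back to \<open>p\<close>.\<close>
  have "P (p + v) = p"
    unfolding P_def using v(2) by (intro prox_eqI g) simp
  moreover have "Q (p - v) = p"
    unfolding Q_def using v(1) by (intro prox_eqI F') simp
  ultimately have "p + v + Q (2 *\<^sub>R P (p + v) - (p + v)) - P (p + v) = p + v"
    by (simp add: scaleR_2)
  from firmly_nonexpansive_iterates_converge[OF firmly_nonexpansive_douglas_rachford[OF fn], of _ s, OF this]
  obtain t where t: "t + Q (2 *\<^sub>R P t - t) - P t = t" "s \<longlonglongrightarrow> t"
    using s unfolding P_def Q_def by blast
  define l where "l = P t"
  \<comment> \<open>Conversely, the fixed-point equation says that \<open>Q\<close> returns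
    \<open>l\<close> at the reflected point, so \<open>t - l\<close> and its negative are
    subgradients of \<open>g\<close> and \<open>F\<close> at \<open>l\<close>.\<close>
  have "Q (2 *\<^sub>R l - t) = l"
    using t(1) by (simp add: l_def algebra_simps)
  then have "is_subgradient (\<lambda>u. ereal (F u)) l (2 *\<^sub>R l - t - l)"
    using prox_subgradient[OF F', of "2 *\<^sub>R l - t"] unfolding Q_def by simp
  then have "is_subgradient (\<lambda>u. ereal (F u)) l (- (t - l))"
    by (simp add: scaleR_2)
  moreover have sub_l: "is_subgradient g l (t - l)"
    unfolding l_def by (rule sub_P)
  ultimately have min: "minimizer (\<lambda>u. ereal (F u) + g u) l"
    by (rule subgradients_sum_minimizer)
  have lim: "(\<lambda>k. P (s k)) \<longlonglongrightarrow> l"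
    unfolding l_def by (rule firmly_nonexpansive_tendsto[OF fn(1) t(2)])
  obtain r where r: "g l = ereal r"
    using sub_l unfolding is_subgradient_def by fastforce
  have "(\<lambda>k. g (P (s k))) \<longlonglongrightarrow> ereal r"
  \<comment> \<open>Both bounds tend to \<open>r\<close>: the slopes are constant or converge to
    \<open>t - l\<close>, while \<open>P (s k) - l\<close> tends to 0.\<close>
  proof (rule tendsto_sandwich)
    have "(\<lambda>k. r + (t - l) \<bullet> (P (s k) - l)) \<longlonglongrightarrow> r + (t - l) \<bullet> (l - l)"
      by (intro tendsto_intros lim)
    then show "(\<lambda>k. ereal (r + (t - l) \<bullet> (P (s k) - l))) \<longlonglongrightarrow> ereal r"
      by simp
    have "(\<lambda>k. r - (s k - P (s k)) \<bullet> (l - P (s k))) \<longlonglongrightarrow> r - (t - l) \<bullet> (l - l)"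
      by (intro tendsto_intros lim t)
    then show "(\<lambda>k. ereal (r - (s k - P (s k)) \<bullet> (l - P (s k)))) \<longlonglongrightarrow> ereal r"
      by simp
    have "ereal (r + (t - l) \<bullet> (P (s k) - l)) \<le> g (P (s k))" for k
      using sub_l by (simp add: is_subgradient_def r)
    then show "\<forall>\<^sub>F k in sequentially. ereal (r + (t - l) \<bullet> (P (s k) - l)) \<le> g (P (s k))"
      by simp
    have "g (P (s k)) \<le> ereal (r - (s k - P (s k)) \<bullet> (l - P (s k)))" for k
    proof -
      obtain a where a: "g (P (s k)) = ereal a"
        using sub_P[of "s k"] unfolding is_subgradient_def by fastforce
      have "g (P (s k)) + ereal ((s k - P (s k)) \<bullet> (l - P (s k))) \<le> g l"
        using sub_P[of "s k"] unfolding is_subgradient_def by blast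
      then show ?thesis by (simp add: a r)
    qed
    then show "\<forall>\<^sub>F k in sequentially. g (P (s k)) \<le> ereal (r - (s k - P (s k)) \<bullet> (l - P (s k)))"
      by simp
  qed
  then show ?thesis
    using min lim r unfolding P_def by auto
qed

section \<open>Transfer from the matrix setting and the weight \<open>\<rho>\<close>\<close>

lemma independent_eigenvector_columns_imp_invertible:
  assumes "independent_eigenvector_columns W V"
  shows "invertible V"
proof -
  have inj: "inj (\<lambda>j. column j V)" and ind: "independent (columns V)"
    using assms by (auto simp: independent_eigenvector_columns_def)
  have "columns V = range (\<lambda>j. column j V)"
    by (auto simp: columns_def)
  \<comment> \<open>Injectivity counts the columns without repetition; independence then gives full
    rank.\<close>
  then have "card (columns V) = CARD('a)"
    using inj by (simp add: card_image)
  then have "rank V = CARD('a)"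
    using ind by (simp add: column_rank_def dim_eq_card_independent)
  then have "inj ((*v) V)"
    by (simp add: full_rank_injective)
  then show ?thesis
    by (simp add: invertible_left_inverse matrix_left_invertible_injective)
qed

text \<open>The iteration uses the proximal map of f / \<rho> together with that of
  \<open>g\<close>, so the objective is divided by \<rho>, which preserves the order of its
  values.\<close>

lemma minimizer_scale_iff:
  assumes "\<rho> > 0" "\<And>u. g u \<noteq> - \<infinity>"
  shows "minimizer (\<lambda>u. ereal (f u) + ereal \<rho> * g u) p
    \<longleftrightarrow> minimizer (\<lambda>u. ereal (inverse \<rho> * f u) + g u) p"
proof -
  have scale: "a + \<rho> * r \<le> b + \<rho> * r' \<longleftrightarrow> inverse \<rho> * a + r \<le> inverse \<rho> * b + r'" for a b r r'
    using mult_le_cancel_left_pos[of \<rho> "inverse \<rho> * a + r" "inverse \<rho> * b + r'"] assms(1)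
    by (simp add: distrib_left mult.assoc[symmetric])
  have "ereal (f u) + ereal \<rho> * g u \<le> ereal (f w) + ereal \<rho> * g w
      \<longleftrightarrow> ereal (inverse \<rho> * f u) + g u \<le> ereal (inverse \<rho> * f w) + g w" for u w
    using assms(1) assms(2)[of u] assms(2)[of w]
    by (cases "g u"; cases "g w") (auto simp: scale)
  then show ?thesis
    by (simp add: is_arg_min_linorder)
qed

theorem mainTheorem5:
  fixes W V :: "real^'n^'n"
    and D :: "real^'n \<Rightarrow> real^'n"
    and g :: "real^'n \<Rightarrow> ereal"
    and f :: "real^'n \<Rightarrow> real"
    and \<rho> :: real
    and ystar :: "real^'n"
    and pstar :: ereal
    and x y z :: "nat \<Rightarrow> real^'n"
  assumes D: "\<And>u. D u = W *v u"
    and diag: "diagonalizable W"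
    and eigenvalues: "\<And>l. eigenvalue_of W l \<Longrightarrow> 0 \<le> l \<and> l \<le> 1"
    and V: "independent_eigenvector_columns W V"
    and g: "closed_fun g" "proper_fun g" "convex_fun g"
    and D_prox: "D = prox (induced_norm V) g"
    and f: "convex_on UNIV f"
    and rho: "\<rho> > 0"
    and ystar: "minimizer (\<lambda>u. ereal (f u) + ereal \<rho> * g u) ystar"
    and pstar: "pstar = ereal (f ystar) + ereal \<rho> * g ystar"
    and x_step: "\<And>k. x (Suc k) = prox (induced_norm V) (\<lambda>u. ereal (inverse \<rho> * f u)) (y k - z k)"
    and y_step: "\<And>k. y (Suc k) = D (x (Suc k) + z k)"
    and z_step: "\<And>k. z (Suc k) = z k + x (Suc k) - y (Suc k)"
  shows "(\<exists>ylim. minimizer (\<lambda>u. ereal (f u) + ereal \<rho> * g u) ylim \<and> y \<longlonglongrightarrow> ylim) \<and>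
         (\<lambda>k. ereal (f (y k)) + ereal \<rho> * g (y k)) \<longlonglongrightarrow> pstar"
proof -
  define A B where "A = (\<lambda>u. matrix_inv V *v u)" and "B = (\<lambda>u. V *v u)"
  have "invertible V"
    using V by (rule independent_eigenvector_columns_imp_invertible)
  then have "V ** matrix_inv V = mat 1 \<and> matrix_inv V ** V = mat 1"
    unfolding invertible_def matrix_inv_def by (rule someI_ex)
  then have AB: "A (B u) = u" "B (A u) = u" for u
    by (simp_all add: A_def B_def matrix_vector_mul_assoc)
  have lin: "linear A" "linear B"
    by (simp_all add: A_def B_def matrix_vector_mul_linear)
  have norm_V: "induced_norm V = (\<lambda>u. norm (A u))"
    by (auto simp: induced_norm_def induced_inner_def A_def norm_eq_sqrt_inner)
  define F where "F = (\<lambda>u. inverse \<rho> * f (B u))"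
  define G where "G = g \<circ> B"
  have conv: "convex_on UNIV (\<lambda>u. inverse \<rho> * f u)"
    using f rho by (intro convex_on_cmul) auto
  have F_comp: "(\<lambda>u. ereal (inverse \<rho> * f u)) \<circ> B = (\<lambda>u. ereal (F u))"
    by (auto simp: F_def)
  have F: "convex_on UNIV F"
    unfolding convex_on_def F_def linear_add[OF lin(2)] linear_scale[OF lin(2)]
    using conv by (auto simp: convex_on_def)
  note F' = convex_on_imp_closed_proper_convex[OF F]
  have G: "closed_fun G" "proper_fun G" "convex_fun G"
    unfolding G_def using g closed_convex_fun_comp_linear[OF lin(2)]
    by (auto simp: proper_fun_def) (metis AB(2))
  have prox_f: "prox (induced_norm V) (\<lambda>u. ereal (inverse \<rho> * f u)) u
      = B (prox norm (\<lambda>u. ereal (F u)) (A u))" for u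
    unfolding norm_V F_comp[symmetric]
    by (rule prox_linear_change) (use F' lin AB in \<open>auto simp: F_comp\<close>)
  have D_eq: "D u = B (prox norm G (A u))" for u
    unfolding D_prox norm_V G_def
    by (rule prox_linear_change) (use G lin AB in \<open>auto simp: G_def\<close>)
  have g_MInf: "g u \<noteq> - \<infinity>" for u
    using g(2) by (simp add: proper_fun_def)
  have min_iff: "minimizer (\<lambda>u. ereal (f u) + ereal \<rho> * g u) (B p)
      \<longleftrightarrow> minimizer (\<lambda>u. ereal (F u) + G u) p" for p
    unfolding minimizer_scale_iff[OF rho g_MInf] is_arg_min_linorder F_def G_def o_def
    by (metis AB(2))
  \<comment> \<open>The mixed indices make the proximal map of \<open>G\<close> at
    \<open>s k\<close> the coordinate vector of \<open>y (Suc k)\<close>, one index later.\<close>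
  define s where "s = (\<lambda>k. A (x (Suc k) + z k))"
  have y_s: "y (Suc k) = B (prox norm G (s k))" for k
    by (simp add: y_step D_eq s_def)
  have "s (Suc k) = s k + prox norm (\<lambda>u. ereal (F u)) (2 *\<^sub>R prox norm G (s k) - s k) - prox norm G (s k)" for k
  proof -
    have Ay: "A (y (Suc k)) = prox norm G (s k)"
      by (simp add: y_s AB)
    \<comment> \<open>The multiplier is the residual of the proximal step, so y - z becomes the
      reflection 2 P s - s in coordinates.\<close>
    have Az: "A (z (Suc k)) = s k - prox norm G (s k)"
      by (simp add: z_step s_def linear_add[OF lin(1)] linear_diff[OF lin(1)] Ay[unfolded s_def linear_add[OF lin(1)]])
    have "A (x (Suc (Suc k))) = prox norm (\<lambda>u. ereal (F u)) (A (y (Suc k)) - A (z (Suc k)))"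
      by (simp only: x_step prox_f AB linear_diff[OF lin(1)])
    then show ?thesis
      unfolding s_def[THEN fun_cong, of "Suc k"] linear_add[OF lin(1)] Az Ay
      by (simp add: scaleR_2 algebra_simps)
  qed
  moreover have "minimizer (\<lambda>u. ereal (F u) + G u) (A ystar)"
    using ystar by (simp add: AB flip: min_iff)
  ultimately obtain l where l: "minimizer (\<lambda>u. ereal (F u) + G u) l"
      "(\<lambda>k. prox norm G (s k)) \<longlonglongrightarrow> l" "(\<lambda>k. G (prox norm G (s k))) \<longlonglongrightarrow> G l"
    using douglas_rachford_converges[OF F G] by blast
  have min: "minimizer (\<lambda>u. ereal (f u) + ereal \<rho> * g u) (B l)"
    using l(1) by (simp add: min_iff)
  have "(\<lambda>k. y (Suc k)) \<longlonglongrightarrow> B l"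
    unfolding y_s using l(2) lin(2) bounded_linear.tendsto linear_conv_bounded_linear by blast
  then have y_lim: "y \<longlonglongrightarrow> B l"
    by (rule LIMSEQ_imp_Suc)
  have "continuous_on UNIV f"
    using f by (simp add: convex_on_continuous)
  then have f_lim: "(\<lambda>k. ereal (f (y k))) \<longlonglongrightarrow> ereal (f (B l))"
    using y_lim continuous_on_tendsto_compose[of UNIV f] by simp
  \<comment> \<open>The shift discards \<open>y 0\<close>, an arbitrary initial point at which
    \<open>g\<close> may be infinite.\<close>
  have "(\<lambda>k. g (y (Suc k))) \<longlonglongrightarrow> g (B l)"
    using l(3) by (simp add: y_s G_def)
  then have "(\<lambda>k. g (y k)) \<longlonglongrightarrow> g (B l)"
    by (rule LIMSEQ_imp_Suc)
  then have "(\<lambda>k. ereal \<rho> * g (y k)) \<longlonglongrightarrow> ereal \<rho> * g (B l)"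
    by (intro tendsto_cmult_ereal) auto
  then have "(\<lambda>k. ereal (f (y k)) + ereal \<rho> * g (y k)) \<longlonglongrightarrow> ereal (f (B l)) + ereal \<rho> * g (B l)"
    using f_lim by (intro tendsto_add_ereal_general) auto
  \<comment> \<open>\<open>B l\<close> and \<open>ystar\<close> are both minimizers, so their values
    agree even if the points differ.\<close>
  also have "ereal (f (B l)) + ereal \<rho> * g (B l) = pstar"
    using min ystar unfolding pstar is_arg_min_linorder by (blast intro: antisym)
  finally show ?thesis
    using min y_lim by blast
qed

end
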